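(* Let $k,n$ be integers with $0\le k\le n$. Then, for all complex $x$ with $|x|<\tfrac12$, $$Hl\left(\tfrac12,(2k+1)(k-n);\,2(k-n),\,2k+1;\,2k+1,\,2k+1;\,x\right)=4^k\binom{n+k}{n}^{-1}\binom{n}{k}^{-1}\sum_{i=0}^{n-k}\binom{2n-2i}{2k}\binom{n}{i}r_{n,k+i}(1-2x)^{2i}$$ and $$Hl\left(\tfrac12,(2k+1)(k-n);\,2(k-n),\,2k+1;\,2k+1,\,2k+1;\,x\right)=\sum_{j=0}^{n-k}4^j\binom{n-k}{j}\frac{(k+1/2)_j}{(2k+1)_j}(x^2-x)^j.$$
   Context: Heun function: for $a\notin\{0,1\}$, $\gamma\notin\{0,-1,-2,\dots\}$ and $\epsilon$ defined by $\alpha+\beta+1=\gamma+\delta+\epsilon$, $Hl(a,q;\alpha,\beta;\gamma,\delta;x)$ denotes the (local) Heun function, i.e. the solution $u(x)$, analytic near $x=0$ and normalized by $u(0)=1$, of $$u''(x)+\left(\frac{\gamma}{x}+\frac{\delta}{x-1}+\frac{\epsilon}{x-a}\right)u'(x)+\frac{\alpha\beta x-q}{x(x-1)(x-a)}u(x)=0.$$ (For $a=\tfrac12$ its power series at $0$ converges for $|x|<\tfrac12$.) Notation: $(y)_0:=1$, $(y)_l:=y(y+1)\cdots(y+l-1)$ for $l\ge1$; for $0\le j\le n$, $r_{n,j}:=\binom{n}{j}^{-1}4^{-n}\binom{2j}{j}\binom{2n-2j}{n-j}$. *)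

theory Defs
  imports "HOL-Complex_Analysis.Complex_Analysis"
begin

text \<open>
  The exponent at \<open>a\<close> is not a separate parameter: it is determined by Fuchs' relation
  \<open>\<alpha> + \<beta> + 1 = \<gamma> + \<delta> + \<epsilon>\<close>. The equation is required on a punctured neighbourhood of \<open>0\<close>
  because its coefficients are singular at \<open>0\<close>.
\<close>

definition local_heun_solution ::
    "complex \<Rightarrow> complex \<Rightarrow> complex \<Rightarrow> complex \<Rightarrow> complex \<Rightarrow> complex \<Rightarrow> (complex \<Rightarrow> complex) \<Rightarrow> bool"
  where
  "local_heun_solution a q \<alpha> \<beta> \<gamma> \<delta> u \<longleftrightarrow>
     u analytic_on {0} \<and> u 0 = 1 \<and>
     (let \<epsilon> = \<alpha> + \<beta> + 1 - \<gamma> - \<delta> in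
        \<forall>\<^sub>F x in at 0.
          deriv (deriv u) x + (\<gamma> / x + \<delta> / (x - 1) + \<epsilon> / (x - a)) * deriv u x
            + (\<alpha> * \<beta> * x - q) / (x * (x - 1) * (x - a)) * u x = 0)"

text \<open>
  For \<open>a \<notin> {0, 1}\<close> and \<open>\<gamma> \<notin> {0, -1, -2, \<dots>}\<close> any two local solutions agree near \<open>0\<close>, so they have the
  same Taylor series at \<open>0\<close>. The Heun function is the sum of that series; it is meaningful only for
  such parameters and inside the disc of convergence.
\<close>

definition Hl ::
    "complex \<Rightarrow> complex \<Rightarrow> complex \<Rightarrow> complex \<Rightarrow> complex \<Rightarrow> complex \<Rightarrow> complex \<Rightarrow> complex"
  where
  "Hl a q \<alpha> \<beta> \<gamma> \<delta> x =
     eval_fps (THE F. \<exists>u. local_heun_solution a q \<alpha> \<beta> \<gamma> \<delta> u \<and> u has_fps_expansion F) x"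

definition r_coeff :: "nat \<Rightarrow> nat \<Rightarrow> complex" where
  "r_coeff n j = inverse (of_nat (n choose j)) * inverse (4 ^ n)
             * of_nat ((2 * j) choose j) * of_nat ((2 * n - 2 * j) choose (n - j))"

end

theory Submission
  imports Defs
begin

text \<open>
  Put \<open>m = n - k\<close>. The parameters of the theorem satisfy \<open>\<gamma> = \<delta>\<close>, Fuchs' relation gives
  \<open>\<epsilon> = - 2n\<close>, and \<open>\<alpha>\<beta>x - q\<close> is a multiple of \<open>x - 1/2\<close>, so the equation becomes
  symmetric under \<open>x \<mapsto> 1 - x\<close>. In the invariant variable \<open>v = 4(x\<^sup>2 - x)\<close> it turns into the hypergeometric equation (with argument \<open>- v\<close>)
  for the parameters \<open>- m\<close>, \<open>k + 1/2\<close>; \<open>2k + 1\<close>. Since \<open>x = 0\<close> corresponds to \<open>v = 0\<close>, the normalized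
  solution is the terminating hypergeometric series \<open>hyp_poly\<close> evaluated at \<open>v\<close>
  (\<open>heun_solution_hyp_poly\<close>). The three-term recurrence of the Taylor coefficients
  (\<open>heun_recurrence\<close>) shows that no other local solution exists, whence the second formula.

  The first formula is the expansion of the same polynomial at \<open>x = 1/2\<close>, that is, in powers of
  \<open>w = (1 - 2x)\<^sup>2 = 1 + v\<close>. Being again a solution of a hypergeometric equation, its coefficients obey a
  two-term recurrence (\<open>coeff_shifted_hyp_poly_rec\<close>). The leading coefficients in \<open>v\<close> and in \<open>w\<close> agree,
  so starting from the top one the recurrence determines all the others
  (\<open>coeff_shifted_hyp_poly\<close>), and \<open>normalized_coefficient_eq\<close> rewrites them in the binomial form of
  the theorem.
\<close>

section \<open>The Heun function as the unique local solution\<close>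

text \<open>
  The equation is cleared of denominators and multiplied by one further factor \<open>x\<close>, so that it holds
  trivially at \<open>0\<close> and hence on a full neighbourhood, where it can be read as an identity of
  power series.
\<close>

lemma heun_recurrence:
  assumes sol: "local_heun_solution a q \<alpha> \<beta> \<gamma> \<delta> u" and F: "u has_fps_expansion F"
    and a: "a \<noteq> 0"
  shows "a * of_nat (Suc N) * (of_nat N + \<gamma>) * fps_nth F (Suc N) =
    ((1 + a) * of_nat N * (of_nat N - 1)
       + (\<gamma> * (1 + a) + \<delta> * a + (\<alpha> + \<beta> + 1 - \<gamma> - \<delta>)) * of_nat N + q) * fps_nth F N
     - (if N = 0 then 0 else (of_nat N - 1 + \<alpha>) * (of_nat N - 1 + \<beta>) * fps_nth F (N - 1))"
proof -
  define \<epsilon> where "\<epsilon> = \<alpha> + \<beta> + 1 - \<gamma> - \<delta>"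
  define b where "b = \<gamma> * (1 + a) + \<delta> * a + \<epsilon>"
  define f where "f = (\<lambda>x. x * (x * (x * (x * deriv (deriv u) x)) - (1 + a) * (x * (x * deriv (deriv u) x))
      + a * (x * deriv (deriv u) x) + (\<alpha> + \<beta> + 1) * (x * (x * deriv u x)) - b * (x * deriv u x)
      + (\<gamma> * a) * deriv u x + (\<alpha> * \<beta>) * (x * u x) - q * u x))"
  define E where "E = fps_X * (fps_X * (fps_X * fps_deriv (fps_deriv F)))
      - fps_const (1 + a) * (fps_X * (fps_X * fps_deriv (fps_deriv F)))
      + fps_const a * (fps_X * fps_deriv (fps_deriv F))
      + fps_const (\<alpha> + \<beta> + 1) * (fps_X * (fps_X * fps_deriv F)) - fps_const b * (fps_X * fps_deriv F)
      + fps_const (\<gamma> * a) * fps_deriv F + fps_const (\<alpha> * \<beta>) * (fps_X * F) - fps_const q * F"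
  have "\<forall>\<^sub>F x in at 0. x \<in> - {0::complex}"
    by (simp add: eventually_at_filter)
  moreover have "\<forall>\<^sub>F x in at 0. x \<in> - {1::complex}"
    by (intro eventually_at_in_open') auto
  moreover have "\<forall>\<^sub>F x in at 0. x \<in> - {a}"
    using a by (intro eventually_at_in_open') auto
  moreover have "\<forall>\<^sub>F x in at 0.
          deriv (deriv u) x + (\<gamma> / x + \<delta> / (x - 1) + \<epsilon> / (x - a)) * deriv u x
            + (\<alpha> * \<beta> * x - q) / (x * (x - 1) * (x - a)) * u x = 0"
    using sol by (simp add: local_heun_solution_def Let_def \<epsilon>_def)
  ultimately have "\<forall>\<^sub>F x in at 0. f x = 0"
  proof eventually_elim
    case (elim x)
    then have nz: "x \<noteq> 0" "x - 1 \<noteq> 0" "x - a \<noteq> 0" by auto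
    have "f x = x * (x * (x - 1) * (x - a)) * (deriv (deriv u) x
            + (\<gamma> / x + \<delta> / (x - 1) + \<epsilon> / (x - a)) * deriv u x
            + (\<alpha> * \<beta> * x - q) / (x * (x - 1) * (x - a)) * u x)"
    proof -
      have s: "\<alpha> + \<beta> + 1 = \<gamma> + \<delta> + \<epsilon>" by (simp add: \<epsilon>_def)
      have 1: "x * (x - 1) * (x - a) * (\<gamma> / x + \<delta> / (x - 1) + \<epsilon> / (x - a))
          = \<gamma> * (x - 1) * (x - a) + \<delta> * x * (x - a) + \<epsilon> * x * (x - 1)"
        using nz by (simp add: distrib_left mult_ac)
      have 2: "x * (x - 1) * (x - a) * ((\<alpha> * \<beta> * x - q) / (x * (x - 1) * (x - a))) = \<alpha> * \<beta> * x - q"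
        using nz by simp
      have 3: "x * p * (d + A * y + B * z) = x * (p * d + (p * A) * y + (p * B) * z)" for p d A y B z
        by (simp add: algebra_simps)
      show ?thesis
        unfolding 3 1 2 f_def s b_def by (simp add: algebra_simps)
    qed
    then show ?case using elim by simp
  qed
  moreover have "f 0 = 0" by (simp add: f_def)
  ultimately have ev: "\<forall>\<^sub>F x in nhds 0. f x = 0"
    by (simp add: eventually_nhds_conv_at)
  have "f has_fps_expansion fps_X * E"
    unfolding f_def E_def by (intro fps_expansion_intros F)
  moreover have "f has_fps_expansion 0"
  proof -
    have "(\<lambda>_. 0 :: complex) has_fps_expansion 0" by simp
    then show ?thesis using ev by (subst has_fps_expansion_cong) auto
  qed
  ultimately have "fps_X * E = 0"
    using fps_expansion_unique_complex by blast
  then have "E = 0" by simp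
  then have "fps_nth E N = 0" by simp
  then have "(if N = 0 then 0 else if N - 1 = 0 then 0 else if N - 1 - 1 = 0 then 0
        else of_nat (N - 1 - 1 - 1 + 1) * (of_nat (N - 1 - 1 - 1 + 1 + 1) * fps_nth F (N - 1 - 1 - 1 + 1 + 1)))
      - (1 + a) * (if N = 0 then 0 else if N - 1 = 0 then 0
        else of_nat (N - 1 - 1 + 1) * (of_nat (N - 1 - 1 + 1 + 1) * fps_nth F (N - 1 - 1 + 1 + 1)))
      + a * (if N = 0 then 0 else of_nat (N - 1 + 1) * (of_nat (N - 1 + 1 + 1) * fps_nth F (N - 1 + 1 + 1)))
      + (\<alpha> + \<beta> + 1) * (if N = 0 then 0 else if N - 1 = 0 then 0
        else of_nat (N - 1 - 1 + 1) * fps_nth F (N - 1 - 1 + 1))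
      - b * (if N = 0 then 0 else of_nat (N - 1 + 1) * fps_nth F (N - 1 + 1))
      + \<gamma> * a * (of_nat (N + 1) * fps_nth F (N + 1))
      + \<alpha> * \<beta> * (if N = 0 then 0 else fps_nth F (N - 1)) - q * fps_nth F N = 0"
    by (simp only: E_def fps_add_nth fps_sub_nth fps_mult_left_const_nth fps_X_mult_nth fps_deriv_nth)
  note coeff_eq = this
  consider "N = 0" | "N = 1" | "N = 2" | M where "N = Suc (Suc (Suc M))"
    by (metis One_nat_def Suc_1 not0_implies_Suc)
  then show ?thesis
    unfolding \<epsilon>_def[symmetric] b_def[symmetric]
    by cases (use coeff_eq in \<open>simp_all add: algebra_simps numeral_2_eq_2\<close>)
qed

text \<open>
  The factor \<open>N + \<gamma>\<close> of the highest coefficient in the recurrence never vanishes, so \<open>u 0 = 1\<close>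
  determines everything.
\<close>

lemma heun_expansion_unique:
  assumes "local_heun_solution a q \<alpha> \<beta> \<gamma> \<delta> u" "u has_fps_expansion F"
    and "local_heun_solution a q \<alpha> \<beta> \<gamma> \<delta> v" "v has_fps_expansion G"
    and a: "a \<noteq> 0" and \<gamma>: "\<And>N::nat. of_nat N + \<gamma> \<noteq> 0"
  shows "F = G"
proof (rule fps_ext)
  fix N
  show "fps_nth F N = fps_nth G N"
  proof (induction N rule: less_induct)
    case (less N)
    show ?case
    proof (cases N)
      case 0
      have "u 0 = 1" "v 0 = 1"
        using assms by (simp_all add: local_heun_solution_def)
      then show ?thesis
        using 0 has_fps_expansion_imp_0_eq_fps_nth_0[OF assms(2)]
          has_fps_expansion_imp_0_eq_fps_nth_0[OF assms(4)] by simp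
    next
      case (Suc M)
      have "a * of_nat (Suc M) * (of_nat M + \<gamma>) * fps_nth F (Suc M)
          = a * of_nat (Suc M) * (of_nat M + \<gamma>) * fps_nth G (Suc M)"
        unfolding heun_recurrence[OF assms(1,2) a] heun_recurrence[OF assms(3,4) a]
        using less Suc by simp
      then show ?thesis
        using a \<gamma>[of M] Suc by (simp del: of_nat_Suc)
    qed
  qed
qed

lemma has_fps_expansion_poly:
  "(\<lambda>x::complex. poly p x) has_fps_expansion fps_of_poly p"
  by (simp add: has_fps_expansion_def)

lemma Hl_eq_poly:
  assumes "local_heun_solution a q \<alpha> \<beta> \<gamma> \<delta> (poly U)"
    and "a \<noteq> 0" and "\<And>N::nat. of_nat N + \<gamma> \<noteq> 0"
  shows "Hl a q \<alpha> \<beta> \<gamma> \<delta> x = poly U x"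
proof -
  have "(THE F. \<exists>u. local_heun_solution a q \<alpha> \<beta> \<gamma> \<delta> u \<and> u has_fps_expansion F) = fps_of_poly U"
    using assms has_fps_expansion_poly heun_expansion_unique by (intro the_equality) blast+
  then show ?thesis by (simp add: Hl_def)
qed

section \<open>The hypergeometric polynomial\<close>

text \<open>
  The bridge between differential equations and recurrences. It is used in both directions: at
  \<open>v = 0\<close> to obtain the equation from the coefficients, at \<open>w = 0\<close> to obtain the coefficients from
  the equation.
\<close>

lemma coeff_second_order_operator:
  fixes P :: "complex poly"
  shows "coeff ([:0, r, s:] * pderiv (pderiv P) + [:c, d:] * pderiv P + smult e P) j
    = of_nat (Suc j) * (r * of_nat j + c) * coeff P (Suc j)
      + (s * of_nat j * (of_nat j - 1) + d * of_nat j + e) * coeff P j"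
  by (cases j; cases "j - 1") (auto simp: coeff_pCons coeff_pderiv algebra_simps)

text \<open>
  This is \<open>\<^sub>2F\<^sub>1(- m, k + 1/2; 2k + 1; - v)\<close> as a polynomial in \<open>v\<close>; the sign of the argument absorbs the
  alternating sign of \<open>(- m)\<^sub>j / j!\<close>.
\<close>

definition hyp_poly :: "nat \<Rightarrow> nat \<Rightarrow> complex poly" where
  "hyp_poly k m = (\<Sum>j\<le>m. monom (of_nat (m choose j)
      * (pochhammer (of_nat k + 1 / 2) j / pochhammer (2 * of_nat k + 1) j)) j)"

lemma poly_hyp_poly:
  "poly (hyp_poly k m) v = (\<Sum>j\<le>m. of_nat (m choose j)
      * (pochhammer (of_nat k + 1 / 2) j / pochhammer (2 * of_nat k + 1) j) * v ^ j)"
  by (simp add: hyp_poly_def poly_sum poly_monom)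

lemma coeff_hyp_poly:
  "coeff (hyp_poly k m) j = of_nat (m choose j)
      * (pochhammer (of_nat k + 1 / 2) j / pochhammer (2 * of_nat k + 1) j)"
  by (auto simp: hyp_poly_def coeff_sum binomial_eq_0)

lemma of_nat_double_plus_nz: "2 * of_nat k + 1 + of_nat j \<noteq> (0::complex)"
proof -
  have "2 * of_nat k + 1 + of_nat j = (of_nat (Suc (2 * k + j)) :: complex)" by simp
  then show ?thesis by (metis of_nat_eq_0_iff nat.distinct(1))
qed

text \<open>
  The value is \<open>4\<^sup>N (1/2)\<^sub>N\<close>. In terms of this quantity the half-integral Pochhammer symbols and the
  binomial coefficients of the theorem become plain products with a one-factor recursion.
\<close>

definition double_fact_ratio :: "nat \<Rightarrow> complex" where
  "double_fact_ratio N = fact (2 * N) / fact N"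

lemma double_fact_ratio_nz [simp]: "double_fact_ratio N \<noteq> 0"
  by (simp add: double_fact_ratio_def)

lemma double_fact_ratio_Suc:
  "double_fact_ratio (Suc N) = 2 * (2 * of_nat N + 1) * double_fact_ratio N"
proof -
  have "fact (2 * Suc N) = 2 * of_nat (Suc N) * (2 * of_nat N + 1) * (fact (2 * N) :: complex)"
    by (simp add: algebra_simps)
  then show ?thesis
    by (simp add: double_fact_ratio_def fact_Suc[of N] del: fact_Suc of_nat_Suc)
qed

lemma pochhammer_half:
  "pochhammer (of_nat k + 1 / 2 :: complex) m = double_fact_ratio (k + m) / (4 ^ m * double_fact_ratio k)"
proof (induction m)
  case (Suc m)
  show ?case
    unfolding pochhammer_Suc Suc.IH by (simp add: double_fact_ratio_Suc field_simps)
qed simp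

lemma pochhammer_double:
  "pochhammer (2 * of_nat k + 1 :: complex) m = fact (2 * k + m) / fact (2 * k)"
  by (induction m) (simp_all add: pochhammer_Suc algebra_simps add_divide_distrib)

lemma binomial_Suc_absorb:
  "of_nat (Suc j) * (of_nat (m choose Suc j) :: complex) = of_nat (m choose j) * (of_nat m - of_nat j)"
proof (cases "j \<le> m")
  case True
  have "Suc j * (m choose Suc j) = (m choose j) * (m - j)"
    by (metis binomial_absorb_comp binomial_absorption mult.commute)
  then show ?thesis using True by (metis of_nat_diff of_nat_mult)
qed (simp add: binomial_eq_0)

lemma hyp_poly_ode:
  fixes k m :: nat
  defines "a \<equiv> - of_nat m :: complex" and "b \<equiv> of_nat k + 1 / 2 :: complex"
    and "c \<equiv> 2 * of_nat k + 1 :: complex" and "Q \<equiv> hyp_poly k m"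
  shows "[:0, 1, 1:] * pderiv (pderiv Q) + [:c, a + b + 1:] * pderiv Q + smult (a * b) Q = 0"
proof (rule poly_eqI)
  fix j
  have nz: "c + of_nat j \<noteq> 0"
    unfolding c_def by (rule of_nat_double_plus_nz)
  define p where "p = pochhammer b j / pochhammer c j"
  have "(of_nat j + c) * coeff Q (Suc j) = of_nat (m choose Suc j) * ((of_nat j + b) * p)"
    using nz unfolding Q_def coeff_hyp_poly pochhammer_Suc b_def[symmetric] c_def[symmetric] p_def
    by (simp add: add.commute)
  then have "of_nat (Suc j) * (of_nat j + c) * coeff Q (Suc j)
      = (of_nat (Suc j) * of_nat (m choose Suc j)) * ((of_nat j + b) * p)"
    by (simp only: mult.assoc)
  also have "\<dots> = - ((of_nat j + a) * (of_nat j + b)) * coeff Q j"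
    unfolding binomial_Suc_absorb Q_def coeff_hyp_poly b_def[symmetric] c_def[symmetric] p_def[symmetric] a_def
    by (simp add: algebra_simps)
  finally have "of_nat (Suc j) * (of_nat j + c) * coeff Q (Suc j) = - ((of_nat j + a) * (of_nat j + b)) * coeff Q j" .
 then show "coeff ([:0, 1, 1:] * pderiv (pderiv Q) + [:c, a + b + 1:] * pderiv Q + smult (a * b) Q) j = coeff 0 j"
    unfolding coeff_second_order_operator by (simp add: algebra_simps)
qed

text \<open>
  With \<open>v = 4x(x - 1)\<close> one has \<open>1 + v = 4(x - 1/2)\<^sup>2\<close>, and the Heun operator applied to a function of
  \<open>v\<close> is \<open>4 / (x(x - 1))\<close> times the hypergeometric operator. Here \<open>- 2m = \<alpha>\<close> and the factor
  \<open>x - 1/2\<close> of \<open>\<alpha>\<beta>x - q\<close> cancels against the denominator.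
\<close>

lemma heun_solution_hyp_poly:
  fixes k m :: nat
  shows "local_heun_solution (1 / 2) (- (2 * of_nat k + 1) * of_nat m) (- 2 * of_nat m)
    (2 * of_nat k + 1) (2 * of_nat k + 1) (2 * of_nat k + 1) (poly (pcompose (hyp_poly k m) [:0, -4, 4:]))"
proof -
  define Q where "Q = hyp_poly k m"
  define U where "U = pcompose Q [:0, -4, 4:]"
  define c :: complex where "c = 2 * of_nat k + 1"
  define M :: complex where "M = of_nat m"
  have D: "deriv (poly P) = poly (pderiv P)" for P :: "complex poly"
    by (rule ext) (simp add: DERIV_imp_deriv poly_DERIV)
  have ode: "v * (1 + v) * poly (pderiv (pderiv Q)) v + (c + (c / 2 + 1 - M) * v) * poly (pderiv Q) v
      - M * c / 2 * poly Q v = 0" for v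
    using arg_cong[OF hyp_poly_ode[of k m], of "\<lambda>p. poly p v"]
    unfolding Q_def c_def M_def by (simp add: algebra_simps add_divide_distrib)
  have "\<forall>\<^sub>F x in at 0. x \<in> - {0::complex}"
    by (simp add: eventually_at_filter)
  moreover have "\<forall>\<^sub>F x in at 0. x \<in> - {1::complex}"
    by (intro eventually_at_in_open') auto
  moreover have "\<forall>\<^sub>F x in at 0. x \<in> - {1 / 2::complex}"
    by (intro eventually_at_in_open') auto
  ultimately have ev: "\<forall>\<^sub>F x in at 0. poly (pderiv (pderiv U)) x
      + (c / x + c / (x - 1) + (- 2 * M + c + 1 - c - c) / (x - 1 / 2)) * poly (pderiv U) x
      + (- 2 * M * c * x - (- c * M)) / (x * (x - 1) * (x - 1 / 2)) * poly U x = 0"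
  proof eventually_elim
    case (elim x)
    then have nz: "x \<noteq> 0" "x - 1 \<noteq> 0" "x - 1 / 2 \<noteq> 0" by auto
    define v where "v = 4 * (x * (x - 1))"
    have v: "poly [:0, -4, 4:] x = v" by (simp add: v_def algebra_simps)
    define y0 where "y0 = poly Q v"
    define y1 where "y1 = poly (pderiv Q) v"
    define y2 where "y2 = poly (pderiv (pderiv Q)) v"
    have U0: "poly U x = y0"
      by (simp only: U_def poly_pcompose v y0_def)
    have U1: "poly (pderiv U) x = 8 * (x - 1 / 2) * y1"
      unfolding U_def pderiv_pcompose poly_mult poly_pcompose v y1_def
      by (simp add: pderiv_pCons algebra_simps)
    have U2: "poly (pderiv (pderiv U)) x = 64 * (x - 1 / 2)\<^sup>2 * y2 + 8 * y1"
      unfolding U_def pderiv_pcompose pderiv_mult poly_add poly_mult poly_pcompose v y1_def y2_def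
      by (simp add: pderiv_pCons algebra_simps power2_eq_square)
    have o: "v * (1 + v) * y2 + (c + (c / 2 + 1 - M) * v) * y1 - M * c / 2 * y0 = 0"
      unfolding y0_def y1_def y2_def by (rule ode)
    have A: "(c / x + c / (x - 1) + (- 2 * M + c + 1 - c - c) / (x - 1 / 2)) * (8 * (x - 1 / 2) * y1)
       = (16 * c * (x - 1 / 2)\<^sup>2 / (x * (x - 1)) + 8 * (1 - 2 * M - c)) * y1"
    proof -
      have "c / x + c / (x - 1) = 2 * c * (x - 1 / 2) / (x * (x - 1))"
        using nz by (simp add: field_simps)
      moreover have "(2 * c * h / w + e / h) * (8 * h * y1) = (16 * c * h\<^sup>2 / w + 8 * e) * y1"
        if "h \<noteq> 0" for h w e
        using that by (simp add: algebra_simps power2_eq_square)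
      moreover have "- 2 * M + c + 1 - c - c = 1 - 2 * M - c" by simp
      ultimately show ?thesis using nz(3) by (simp only: not_False_eq_True)
    qed
    have B: "(- 2 * M * c * x - (- c * M)) / (x * (x - 1) * (x - 1 / 2)) = - 2 * M * c / (x * (x - 1))"
    proof -
      have "- 2 * M * c * x - (- c * M) = - 2 * M * c * (x - 1 / 2)" by (simp add: algebra_simps)
      then show ?thesis using nz by simp
    qed
    have "64 * (x - 1 / 2)\<^sup>2 * y2 + 8 * y1 
        + (16 * c * (x - 1 / 2)\<^sup>2 / (x * (x - 1)) + 8 * (1 - 2 * M - c)) * y1
        + - 2 * M * c / (x * (x - 1)) * y0
      = 4 / (x * (x - 1)) * (v * (1 + v) * y2 + (c + (c / 2 + 1 - M) * v) * y1 - M * c / 2 * y0)"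
    proof -
      have w: "1 + v = 4 * (x - 1 / 2)\<^sup>2" by (simp add: v_def power2_eq_square algebra_simps)
      have p: "x * (x - 1) = v / 4" by (simp add: v_def)
      have "v \<noteq> 0" using nz by (simp add: v_def)
      moreover have "64 * (x - 1 / 2)\<^sup>2 = 16 * (1 + v)" "16 * c * (x - 1 / 2)\<^sup>2 = 4 * c * (1 + v)"
        using w by simp_all
      ultimately show ?thesis unfolding p by (simp add: field_simps)
    qed
    then show ?case
      unfolding U0 U1 U2 A B o mult_zero_right .
  qed
  have "poly U analytic_on {0}"
    using has_fps_expansion_imp_analytic_0[OF has_fps_expansion_poly] .
  moreover have "poly U 0 = 1"
    by (simp add: U_def poly_pcompose Q_def poly_0_coeff_0 coeff_hyp_poly)
  ultimately have "local_heun_solution (1 / 2) (- c * M) (- 2 * M) c c c (poly U)"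
    unfolding local_heun_solution_def Let_def D using ev by blast
  then show ?thesis unfolding U_def Q_def c_def M_def .
qed

section \<open>Expansion at the singular point \<open>x = 1/2\<close>\<close>

text \<open>
  Substituting \<open>v = w - 1\<close> exchanges two singular points of the hypergeometric equation and replaces
  its parameter \<open>c = 2k + 1\<close> by \<open>a + b + 1 - c = 1/2 - (k + m)\<close>.
\<close>

lemma coeff_shifted_hyp_poly_rec:
  fixes k m i :: nat
  defines "P \<equiv> pcompose (hyp_poly k m) [:-1, 1:]"
  shows "of_nat (Suc i) * (of_nat (k + m) - of_nat i - 1 / 2) * coeff P (Suc i)
    = (of_nat m - of_nat i) * (of_nat k + of_nat i + 1 / 2) * coeff P i"
proof -
  define b :: complex where "b = of_nat k + 1 / 2"
  define c :: complex where "c = 2 * of_nat k + 1"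
  define M :: complex where "M = of_nat m"
  define Q where "Q = hyp_poly k m"
  have PQ: "P = pcompose Q [:-1, 1:]" by (simp add: P_def Q_def)
  have d1: "pderiv P = pcompose (pderiv Q) [:-1, 1:]"
    by (simp add: PQ pderiv_pcompose pderiv_pCons)
  have d2: "pderiv (pderiv P) = pcompose (pderiv (pderiv Q)) [:-1, 1:]"
    by (simp add: d1 pderiv_pcompose pderiv_pCons)
  have c0: "pcompose [:0, 1, 1:] [:-1, 1:] = ([:0, -1, 1:] :: complex poly)"
    and c1: "pcompose [:c, - M + b + 1:] [:-1, 1:] = [:c + M - b - 1, - M + b + 1:]"
    by (simp_all add: pcompose_pCons)
  have "pcompose ([:0, 1, 1:] * pderiv (pderiv Q) + [:c, - M + b + 1:] * pderiv Q + smult (- M * b) Q) [:-1, 1:] = 0"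
    unfolding Q_def b_def c_def M_def hyp_poly_ode by simp
  then have "[:0, -1, 1:] * pderiv (pderiv P) + [:c + M - b - 1, - M + b + 1:] * pderiv P + smult (- M * b) P = 0"
    unfolding pcompose_add pcompose_mult pcompose_smult c0 c1 d1[symmetric] d2[symmetric] PQ[symmetric] .
  then have "coeff ([:0, -1, 1:] * pderiv (pderiv P) + [:c + M - b - 1, - M + b + 1:] * pderiv P + smult (- M * b) P) i = 0"
    by simp
  then show ?thesis
    unfolding coeff_second_order_operator unfolding b_def c_def M_def
    by (simp add: algebra_simps add_divide_distrib diff_divide_distrib)
qed

lemma degree_hyp_poly: "degree (hyp_poly k m) = m"
proof (rule antisym)
  show "degree (hyp_poly k m) \<le> m"
    by (rule degree_le) (simp add: coeff_hyp_poly binomial_eq_0)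
  show "m \<le> degree (hyp_poly k m)"
    by (rule le_degree) (simp add: coeff_hyp_poly pochhammer_half pochhammer_double)
qed

text \<open>
  Induction runs downwards from \<open>i = m\<close>, where the coefficient is the leading coefficient of
  \<open>hyp_poly k m\<close> and therefore unaffected by the shift. For \<open>i < m\<close> the factors \<open>m - i\<close> and
  \<open>k + i + 1/2\<close> in the recurrence are nonzero, so each coefficient follows from the next one.
\<close>

lemma coeff_shifted_hyp_poly:
  fixes k m i :: nat
  assumes "i \<le> m"
  shows "coeff (pcompose (hyp_poly k m) [:-1, 1:]) i
    = of_nat (m choose i) * double_fact_ratio (k + m - i) * double_fact_ratio (k + i)
      / (4 ^ m * (double_fact_ratio k)\<^sup>2 * pochhammer (2 * of_nat k + 1) m)"
  using assms
proof (induction rule: inc_induct)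
  case base
  have "coeff (pcompose (hyp_poly k m) [:-1, 1:]) m = coeff (hyp_poly k m) m"
    using lead_coeff_comp[of "[:-1, 1::complex:]" "hyp_poly k m"]
    by (simp add: degree_hyp_poly degree_pcompose)
  then show ?case
    by (simp only: coeff_hyp_poly pochhammer_half) (simp add: power2_eq_square)
next
  case (step i)
  define l where "l = m - Suc i"
  have m: "m = Suc (l + i)" using step by (simp add: l_def)
  define D where "D = 4 ^ m * (double_fact_ratio k)\<^sup>2 * pochhammer (2 * of_nat k + 1) m"
  define p where "p = coeff (pcompose (hyp_poly k m) [:-1, 1:])"
  define B where "B = (of_nat (m choose i) :: complex)"
  define B' where "B' = (of_nat (m choose Suc i) :: complex)"
  define X where "X = double_fact_ratio (k + l)"
  define Y where "Y = double_fact_ratio (k + i)"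
  define s :: complex where "s = 2 * of_nat (k + i) + 1"
  define t :: complex where "t = 2 * of_nat (k + l) + 1"
  have sub: "k + m - i = Suc (k + l)" "k + m - Suc i = k + l" by (simp_all add: m)
  have nz: "(of_nat (Suc l) :: complex) \<noteq> 0" "s \<noteq> 0"
    using of_nat_double_plus_nz[of "k + i" 0] by (simp_all del: of_nat_Suc add: s_def)
  have rec: "of_nat (Suc l) * s * p i = of_nat (Suc i) * t * p (Suc i)"
  proof -
    have 1: "of_nat (Suc l) = (of_nat m - of_nat i :: complex)"
      and 2: "s = 2 * (of_nat k + of_nat i + 1 / 2)"
      and 3: "t = 2 * (of_nat (k + m) - of_nat i - 1 / 2)"
      by (simp_all add: m s_def t_def)
    have "of_nat (Suc l) * s * p i = 2 * ((of_nat m - of_nat i) * (of_nat k + of_nat i + 1 / 2) * p i)"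
      unfolding 1 2 by (simp only: mult_ac)
    also have "\<dots> = of_nat (Suc i) * t * p (Suc i)"
      unfolding p_def coeff_shifted_hyp_poly_rec[symmetric] 3 by (simp only: mult_ac)
    finally show ?thesis .
  qed
  have IH: "p (Suc i) = B' * X * (2 * s * Y) / D"
    using step.IH unfolding sub
    by (simp add: p_def D_def B'_def X_def Y_def s_def double_fact_ratio_Suc)
  have absorb: "of_nat (Suc i) * B' = B * of_nat (Suc l)"
    using binomial_Suc_absorb[of i m] by (simp add: B_def B'_def m)
  have "of_nat (Suc l) * s * p i = (of_nat (Suc i) * B') * (t * X * (2 * s * Y) / D)"
    unfolding rec IH by (simp add: mult_ac)
  also have "\<dots> = of_nat (Suc l) * s * (B * (2 * t * X) * Y / D)"
    unfolding absorb by (simp add: mult_ac)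
  finally have "p i = B * (2 * t * X) * Y / D"
    using nz by (metis mult_cancel_left mult_eq_0_iff)
  then show ?case
    unfolding sub double_fact_ratio_Suc
    by (simp add: p_def D_def B_def X_def Y_def t_def)
qed

lemma normalized_coefficient_eq:
  fixes k m i :: nat
  assumes "i \<le> m"
  defines "n \<equiv> k + m"
  shows "4 ^ k * inverse (of_nat ((n + k) choose n)) * inverse (of_nat (n choose k))
        * (of_nat ((2 * n - 2 * i) choose (2 * k)) * of_nat (n choose i) * r_coeff n (k + i))
    = coeff (pcompose (hyp_poly k m) [:-1, 1:]) i"
proof -
  obtain l where m: "m = i + l" using assms(1) le_Suc_ex by blast
  have ch: "of_nat ((a + b) choose a) = (fact (a + b) / (fact a * fact b) :: complex)" for a b
    by (simp add: binomial_fact)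
  have "of_nat ((n + k) choose n) = (fact (2 * k + m) / (fact n * fact k) :: complex)"
  proof -
    have "n + k = 2 * k + m" by (simp add: n_def)
    then show ?thesis by (metis ch)
  qed
  moreover have "of_nat (n choose k) = (fact n / (fact k * fact m) :: complex)"
    using ch[of k m] by (simp add: n_def)
  moreover have "of_nat ((2 * n - 2 * i) choose (2 * k)) = (fact (2 * (k + l)) / (fact (2 * k) * fact (2 * l)) :: complex)"
    using ch[of "2 * k" "2 * l"] by (simp add: n_def m)
  moreover have "of_nat (n choose i) = (fact n / (fact i * fact (k + l)) :: complex)"
    using ch[of i "k + l"] by (simp add: n_def m ac_simps)
  moreover have "of_nat (n choose (k + i)) = (fact n / (fact (k + i) * fact l) :: complex)"
    using ch[of "k + i" l] by (simp add: n_def m ac_simps)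
  moreover have "of_nat (2 * (k + i) choose (k + i)) = (fact (2 * (k + i)) / (fact (k + i) * fact (k + i)) :: complex)"
    by (metis ch mult_2)
  moreover have "of_nat ((2 * n - 2 * (k + i)) choose (n - (k + i))) = (fact (2 * l) / (fact l * fact l) :: complex)"
    using ch[of l l] by (simp add: n_def m mult_2)
  moreover have "of_nat (m choose i) = (fact m / (fact i * fact l) :: complex)"
    using ch[of i l] by (simp add: m)
  moreover have "k + m - i = k + l" by (simp add: m)
  moreover have "(4 :: complex) ^ n = 4 ^ k * 4 ^ m" by (simp add: n_def power_add)
  moreover note facts = calculation
  show ?thesis
    unfolding coeff_shifted_hyp_poly[OF assms(1)] r_coeff_def pochhammer_double double_fact_ratio_def facts
    by (simp add: field_simps power2_eq_square)
qed

theorem mainTheorem8: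
  fixes k n :: nat
  assumes "k \<le> n"
  shows "(\<forall>x::complex. norm x < 1 / 2 \<longrightarrow>
      Hl (1 / 2) ((2 * of_nat k + 1) * (of_nat k - of_nat n))
         (2 * (of_nat k - of_nat n)) (2 * of_nat k + 1)
         (2 * of_nat k + 1) (2 * of_nat k + 1) x
      = 4 ^ k * inverse (of_nat ((n + k) choose n)) * inverse (of_nat (n choose k))
        * (\<Sum>i = 0..n - k. of_nat ((2 * n - 2 * i) choose (2 * k)) * of_nat (n choose i)
             * r_coeff n (k + i) * (1 - 2 * x) ^ (2 * i)))
    \<and> (\<forall>x::complex. norm x < 1 / 2 \<longrightarrow>
      Hl (1 / 2) ((2 * of_nat k + 1) * (of_nat k - of_nat n))
         (2 * (of_nat k - of_nat n)) (2 * of_nat k + 1)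
         (2 * of_nat k + 1) (2 * of_nat k + 1) x
      = (\<Sum>j = 0..n - k. 4 ^ j * of_nat ((n - k) choose j)
           * (pochhammer (of_nat k + 1 / 2) j / pochhammer (2 * of_nat k + 1) j)
           * (x ^ 2 - x) ^ j))"
proof -
  define m where "m = n - k"
  have n: "n = k + m" using assms by (simp add: m_def)
  have par: "(2 * of_nat k + 1) * (of_nat k - of_nat n) = - (2 * of_nat k + 1) * (of_nat m :: complex)"
    "2 * (of_nat k - of_nat n) = - 2 * (of_nat m :: complex)"
    by (simp_all add: n algebra_simps)
  have Hl: "Hl (1 / 2) ((2 * of_nat k + 1) * (of_nat k - of_nat n))
         (2 * (of_nat k - of_nat n)) (2 * of_nat k + 1)
         (2 * of_nat k + 1) (2 * of_nat k + 1) x = poly (hyp_poly k m) (4 * (x ^ 2 - x))" for x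
  proof -
    have "of_nat N + (2 * of_nat k + 1) \<noteq> (0::complex)" for N
      using of_nat_double_plus_nz[of k N] by (simp add: algebra_simps)
    then have "Hl (1 / 2) ((2 * of_nat k + 1) * (of_nat k - of_nat n))
         (2 * (of_nat k - of_nat n)) (2 * of_nat k + 1)
         (2 * of_nat k + 1) (2 * of_nat k + 1) x = poly (pcompose (hyp_poly k m) [:0, -4, 4:]) x"
      unfolding par by (intro Hl_eq_poly heun_solution_hyp_poly) auto
    also have "\<dots> = poly (hyp_poly k m) (4 * (x ^ 2 - x))"
      by (simp add: poly_pcompose power2_eq_square algebra_simps)
    finally show ?thesis .
  qed
  have second: "poly (hyp_poly k m) (4 * (x ^ 2 - x)) = (\<Sum>j = 0..n - k. 4 ^ j * of_nat ((n - k) choose j)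
           * (pochhammer (of_nat k + 1 / 2) j / pochhammer (2 * of_nat k + 1) j)
           * (x ^ 2 - x) ^ j)" for x
    unfolding poly_hyp_poly m_def[symmetric] atMost_atLeast0 power_mult_distrib
    by (intro sum.cong) (simp_all add: mult_ac)
  have first: "poly (hyp_poly k m) (4 * (x ^ 2 - x)) =
      4 ^ k * inverse (of_nat ((n + k) choose n)) * inverse (of_nat (n choose k))
        * (\<Sum>i = 0..n - k. of_nat ((2 * n - 2 * i) choose (2 * k)) * of_nat (n choose i)
             * r_coeff n (k + i) * (1 - 2 * x) ^ (2 * i))" (is "_ = ?C * _") for x
  proof -
    define P where "P = pcompose (hyp_poly k m) [:-1, 1:]"
    have "4 * (x ^ 2 - x) = (1 - 2 * x)\<^sup>2 - 1"
      by (simp add: power2_eq_square algebra_simps)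
    then have "poly (hyp_poly k m) (4 * (x ^ 2 - x)) = poly P ((1 - 2 * x)\<^sup>2)"
      by (simp add: P_def poly_pcompose)
    also have "\<dots> = (\<Sum>i = 0..m. coeff P i * (1 - 2 * x) ^ (2 * i))"
      by (simp add: poly_altdef P_def degree_pcompose degree_hyp_poly power_mult atMost_atLeast0)
    also have "\<dots> = (\<Sum>i = 0..m. ?C * (of_nat ((2 * n - 2 * i) choose (2 * k)) * of_nat (n choose i)
             * r_coeff n (k + i) * (1 - 2 * x) ^ (2 * i)))"
      unfolding P_def n by (intro sum.cong refl) (simp add: normalized_coefficient_eq[symmetric] mult.assoc)
    finally show ?thesis by (simp add: sum_distrib_left m_def)
  qed
  show ?thesis unfolding Hl using first second by blast
qed

end
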